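(* Let $X$ be a real Hilbert space, let $A$ be a closed affine subspace of $X$ with parallel space $U := A - A$, let $v \in X$ with $\|v\| = 1$, let $\beta \in \mathbb{R}$, and let $B := \{x \in X : \langle x, v\rangle = \beta\}$. Suppose that $A \cap B \neq \varnothing$, and let $x \in X$. Then exactly one of the following holds: (i) $P_U(v) = 0$, in which case $P_{A\cap B}(x) = P_A(x)$. (ii) $P_U(v) \neq 0$, in which case $$P_{A\cap B}(x) = P_A(x) + \frac{\beta - \langle P_A(x), v\rangle}{\|P_U(v)\|^2}\, P_U(v).$$
   Context: $\langle\cdot,\cdot\rangle$ is the inner product of $X$ and $\|\cdot\|$ the induced norm. A closed affine subspace is a translate of a closed linear subspace (in particular, it is nonempty); $A - A = \{a - a' : a, a' \in A\}$ is the closed linear subspace parallel to $A$. For a nonempty closed convex set $C \subseteq X$, $P_C : X \to X$ denotes the nearest point mapping (orthogonal projection) onto $C$. *)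

theory Defs
  imports "HOL-Analysis.Analysis"
begin

definition closed_affine_subspace :: "'a::{real_inner,complete_space} set \<Rightarrow> bool" where
  "closed_affine_subspace A \<longleftrightarrow> (\<exists>a U. subspace U \<and> closed U \<and> A = (\<lambda>u. a + u) ` U)"

definition is_nearest_point :: "'a::{real_inner,complete_space} set \<Rightarrow> 'a \<Rightarrow> 'a \<Rightarrow> bool" where
  "is_nearest_point C x p \<longleftrightarrow> p \<in> C \<and> (\<forall>c\<in>C. norm (x - p) \<le> norm (x - c))"

(* The library's closest_point requires heine_borel, that is, finite dimension. The lemma
   nearest_point_ex1 below shows that the description is proper for nonempty closed convex C. *)
definition proj :: "'a::{real_inner,complete_space} set \<Rightarrow> 'a \<Rightarrow> 'a" where
  "proj C x = (THE p. is_nearest_point C x p)"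

lemma nearest_point_aux:
  fixes C :: "'a::{real_inner,complete_space} set"
  assumes "convex C" "p \<in> C" "q \<in> C" and d: "\<And>c. c \<in> C \<Longrightarrow> d \<le> norm (x - c)" "0 \<le> d"
  shows "(norm (p - q))\<^sup>2 \<le> 2 * (norm (x - p))\<^sup>2 + 2 * (norm (x - q))\<^sup>2 - 4 * d\<^sup>2"
proof -
  let ?m = "(1/2) *\<^sub>R p + (1/2) *\<^sub>R q"
  have "?m \<in> C"
    using assms(1-3) by (intro convexD) auto
  then have "d\<^sup>2 \<le> (norm (x - ?m))\<^sup>2"
    using d by (simp add: power_mono)
  moreover have "(norm (p - q))\<^sup>2 =
      2 * (norm (x - p))\<^sup>2 + 2 * (norm (x - q))\<^sup>2 - 4 * (norm (x - ?m))\<^sup>2"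
    unfolding power2_norm_eq_inner
    by (simp add: algebra_simps inner_commute)
  ultimately show ?thesis by linarith
qed

lemma nearest_point_ex1:
  fixes C :: "'a::{real_inner,complete_space} set"
  assumes C: "convex C" "closed C" "C \<noteq> {}"
  shows "\<exists>!p. is_nearest_point C x p"
proof (rule ex_ex1I)
  define d where "d = (INF c\<in>C. norm (x - c))"
  have bdd: "bdd_below ((\<lambda>c. norm (x - c)) ` C)"
    by (rule bdd_belowI[of _ 0]) auto
  have d: "d \<le> norm (x - c)" if "c \<in> C" for c
    unfolding d_def using bdd that by (rule cINF_lower)
  have d0: "0 \<le> d"
    unfolding d_def using C(3) by (intro cINF_greatest) auto
  have "\<exists>c\<in>C. norm (x - c) < d + inverse (real (Suc n))" for n
    using cINF_less_iff[OF C(3) bdd, of "d + inverse (real (Suc n))"] by (simp add: d_def)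
  then obtain s where s: "\<And>n. s n \<in> C" "\<And>n. norm (x - s n) < d + inverse (real (Suc n))"
    by metis
  have lim: "(\<lambda>n. norm (x - s n)) \<longlonglongrightarrow> d"
  proof (rule tendsto_sandwich[OF _ _ tendsto_const])
    show "(\<lambda>n. d + inverse (real (Suc n))) \<longlonglongrightarrow> d"
      using tendsto_add[OF tendsto_const LIMSEQ_inverse_real_of_nat, of d] by simp
    show "\<forall>\<^sub>F n in sequentially. d \<le> norm (x - s n)"
      using d s(1) by simp
    show "\<forall>\<^sub>F n in sequentially. norm (x - s n) \<le> d + inverse (real (Suc n))"
      using s(2) by (intro always_eventually allI less_imp_le)
  qed
  have "Cauchy s"
  proof (rule metric_CauchyI)
    fix e :: real assume e: "e > 0"
    have "(\<lambda>n. (norm (x - s n))\<^sup>2) \<longlonglongrightarrow> d\<^sup>2"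
      by (intro tendsto_power lim)
    then have "\<forall>\<^sub>F n in sequentially. (norm (x - s n))\<^sup>2 < d\<^sup>2 + e\<^sup>2 / 4"
      by (rule order_tendstoD) (use e in auto)
    then obtain M where M: "\<And>n. n \<ge> M \<Longrightarrow> (norm (x - s n))\<^sup>2 < d\<^sup>2 + e\<^sup>2 / 4"
      unfolding eventually_sequentially by blast
    have "dist (s m) (s n) < e" if "m \<ge> M" "n \<ge> M" for m n
    proof -
      have "(norm (s m - s n))\<^sup>2 < e\<^sup>2"
        using nearest_point_aux[OF C(1) s(1) s(1) d d0, of m n] M[OF that(1)] M[OF that(2)]
        by linarith
      then show ?thesis
        using e by (simp add: dist_norm power_less_imp_less_base)
    qed
    then show "\<exists>M. \<forall>m\<ge>M. \<forall>n\<ge>M. dist (s m) (s n) < e" by blast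
  qed
  then obtain p where p: "s \<longlonglongrightarrow> p"
    using Cauchy_convergent convergent_def by blast
  have "p \<in> C"
    using C(2) s(1) p closed_sequentially by blast
  moreover have "norm (x - p) = d"
    by (rule LIMSEQ_unique[OF _ lim]) (intro tendsto_intros p)
  ultimately show "\<exists>p. is_nearest_point C x p"
    using d by (auto simp: is_nearest_point_def)
next
  fix p q assume pq: "is_nearest_point C x p" "is_nearest_point C x q"
  then have "norm (x - p) = norm (x - q)"
    by (auto simp: is_nearest_point_def intro: antisym)
  then have "(norm (p - q))\<^sup>2 \<le> 0"
    using nearest_point_aux[OF C(1), of p q "norm (x - p)" x] pq
    by (auto simp: is_nearest_point_def)
  then show "p = q" by simp
qed

end

theory Submission
  imports Defs
begin

text \<open>
  The nearest point of a translate of a closed subspace \<open>U\<close> is the unique point of the translate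
  whose difference from \<open>x\<close> is orthogonal to \<open>U\<close>. Since \<open>A \<inter> B\<close> is nonempty, it is itself a
  translate, namely of \<open>W = {u \<in> U. \<langle>u, v\<rangle> = 0}\<close>, so this criterion decides all three projections.

  On \<open>U\<close> the functional \<open>\<langle>\<cdot>, v\<rangle>\<close> agrees with \<open>\<langle>\<cdot>, w\<rangle>\<close>, where \<open>w\<close> is the projection of \<open>v\<close> onto \<open>U\<close>.
  If \<open>w = 0\<close>, then \<open>\<langle>\<cdot>, v\<rangle>\<close> is constant on \<open>A\<close>, so that \<open>A \<inter> B = A\<close>. If \<open>w \<noteq> 0\<close>, the direction \<open>w\<close>
  lies in \<open>U\<close> and is orthogonal to \<open>W\<close>: moving from the projection of \<open>x\<close> onto \<open>A\<close> along \<open>w\<close> stays in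
  \<open>A\<close> and keeps the difference from \<open>x\<close> orthogonal to \<open>W\<close>. It remains to pick the multiple of \<open>w\<close>
  that reaches the hyperplane \<open>B\<close>, which is possible because \<open>\<langle>w, v\<rangle> = \<parallel>w\<parallel>\<^sup>2 \<noteq> 0\<close>.
\<close>

text \<open>
  Orthogonality gives minimality by the Pythagorean theorem. Conversely, stepping from the nearest
  point \<open>p\<close> by \<open>u\<close> scaled with \<open>t = \<langle>x - p, u\<rangle> / \<parallel>u\<parallel>\<^sup>2\<close> would lower the squared distance by
  \<open>\<langle>x - p, u\<rangle>\<^sup>2 / \<parallel>u\<parallel>\<^sup>2\<close>.
\<close>

lemma is_nearest_point_translate_iff:
  fixes U :: "'a::{real_inner,complete_space} set"
  assumes U: "subspace U"
  shows "is_nearest_point ((+) a ` U) x p \<longleftrightarrow>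
         p \<in> (+) a ` U \<and> (\<forall>u\<in>U. inner (x - p) u = 0)"
proof
  assume near: "is_nearest_point ((+) a ` U) x p"
  then obtain u0 where u0: "u0 \<in> U" "p = a + u0"
    by (auto simp: is_nearest_point_def)
  have "inner (x - p) u = 0" if u: "u \<in> U" for u
  proof (rule ccontr)
    assume nz: "inner (x - p) u \<noteq> 0"
    then have pos: "inner u u > 0" by auto
    define t where "t = inner (x - p) u / inner u u"
    have t: "t * inner u u = inner (x - p) u"
      using pos by (simp add: t_def)
    have "p + t *\<^sub>R u \<in> (+) a ` U"
      using U u u0 by (auto simp: add.assoc intro!: imageI subspace_add subspace_scale)
    then have "norm (x - p) \<le> norm (x - (p + t *\<^sub>R u))"
      using near unfolding is_nearest_point_def by blast
    then have "inner (x - p) (x - p) \<le> inner ((x - p) - t *\<^sub>R u) ((x - p) - t *\<^sub>R u)"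
      by (simp add: norm_le diff_diff_eq)
    also have "\<dots> = inner (x - p) (x - p) - 2 * t * inner (x - p) u + t * (t * inner u u)"
      by (simp add: inner_diff_left[of "x - p"] inner_diff_right[of _ "x - p"]
          inner_commute[of u "x - p"] right_diff_distrib)
    also have "\<dots> = inner (x - p) (x - p) - t\<^sup>2 * inner u u"
      unfolding t[symmetric] by (simp add: power2_eq_square)
    finally have "t\<^sup>2 * inner u u \<le> 0" by simp
    moreover have "t \<noteq> 0"
      using nz t by auto
    ultimately show False
      using pos by (simp add: mult_le_0_iff)
  qed
  then show "p \<in> (+) a ` U \<and> (\<forall>u\<in>U. inner (x - p) u = 0)"
    using near by (auto simp: is_nearest_point_def)
next
  assume p: "p \<in> (+) a ` U \<and> (\<forall>u\<in>U. inner (x - p) u = 0)"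
  have "norm (x - p) \<le> norm (x - c)" if c: "c \<in> (+) a ` U" for c
  proof -
    have "p - c \<in> U"
      using p c subspace_diff[OF U] by auto
    then have "orthogonal (x - p) (p - c)"
      using p by (auto simp: orthogonal_def)
    then have "(norm (x - c))\<^sup>2 = (norm (x - p))\<^sup>2 + (norm (p - c))\<^sup>2"
      using norm_add_Pythagorean[of "x - p" "p - c"] by simp
    then have "(norm (x - p))\<^sup>2 \<le> (norm (x - c))\<^sup>2" by simp
    then show ?thesis
      by (rule power2_le_imp_le) simp
  qed
  then show "is_nearest_point ((+) a ` U) x p"
    using p by (auto simp: is_nearest_point_def)
qed

lemma proj_translate_eq_iff:
  fixes U :: "'a::{real_inner,complete_space} set"
  assumes U: "subspace U" "closed U"
  shows "proj ((+) a ` U) x = p \<longleftrightarrow>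
         p \<in> (+) a ` U \<and> (\<forall>u\<in>U. inner (x - p) u = 0)"
proof -
  have "\<exists>!q. is_nearest_point ((+) a ` U) x q"
    using U subspace_0[OF U(1)]
    by (intro nearest_point_ex1 convex_translation closed_translation subspace_imp_convex) auto
  then have "proj ((+) a ` U) x = p \<longleftrightarrow> is_nearest_point ((+) a ` U) x p"
    unfolding proj_def by (metis theI')
  then show ?thesis
    by (simp add: is_nearest_point_translate_iff[OF U(1)])
qed

lemma proj_subspace_eq_iff:
  fixes U :: "'a::{real_inner,complete_space} set"
  assumes "subspace U" "closed U"
  shows "proj U x = p \<longleftrightarrow> p \<in> U \<and> (\<forall>u\<in>U. inner (x - p) u = 0)"
  using proj_translate_eq_iff[OF assms, of 0] by simp

lemma translate_subspace_rebase:
  assumes U: "subspace U" and c: "c \<in> (+) a ` U"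
  shows "(+) a ` U = (+) c ` U"
proof -
  obtain u where u: "u \<in> U" "c = a + u"
    using c by auto
  show ?thesis
  proof (intro equalityI subsetI)
    fix y assume "y \<in> (+) a ` U"
    then obtain z where z: "z \<in> U" "y = a + z" by auto
    then have "y = c + (z - u)" "z - u \<in> U"
      using u subspace_diff[OF U] by auto
    then show "y \<in> (+) c ` U" by blast
  next
    fix y assume "y \<in> (+) c ` U"
    then obtain z where z: "z \<in> U" "y = c + z" by auto
    then have "y = a + (u + z)" "u + z \<in> U"
      using u subspace_add[OF U] by (auto simp: add.assoc)
    then show "y \<in> (+) a ` U" by blast
  qed
qed

lemma differences_translate_subspace:
  assumes U: "subspace U"
  shows "{y - z | y z. y \<in> (+) a ` U \<and> z \<in> (+) a ` U} = U"
proof (intro equalityI subsetI)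
  fix u assume "u \<in> {y - z | y z. y \<in> (+) a ` U \<and> z \<in> (+) a ` U}"
  then show "u \<in> U"
    using subspace_diff[OF U] by auto
next
  fix u assume "u \<in> U"
  then have "u = (a + u) - (a + 0)" "a + u \<in> (+) a ` U" "a + 0 \<in> (+) a ` U"
    using subspace_0[OF U] by (simp, blast, blast)
  then show "u \<in> {y - z | y z. y \<in> (+) a ` U \<and> z \<in> (+) a ` U}"
    by blast
qed

theorem theorem1p1:
  fixes A B U :: "'a::{real_inner,complete_space} set"
    and v x :: 'a and \<beta> :: real
  assumes "closed_affine_subspace A"
    and "U = {a - a' | a a'. a \<in> A \<and> a' \<in> A}"
    and "norm v = 1"
    and "B = {y. inner y v = \<beta>}"
    and "A \<inter> B \<noteq> {}"
  shows "(proj U v = 0 \<and> proj (A \<inter> B) x = proj A x) \<noteq>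
         (proj U v \<noteq> 0 \<and>
            proj (A \<inter> B) x =
              proj A x + ((\<beta> - inner (proj A x) v) / (norm (proj U v))\<^sup>2) *\<^sub>R proj U v)"
proof -
  obtain a V where V: "subspace V" "closed V" "A = (+) a ` V"
    using assms(1) unfolding closed_affine_subspace_def by blast
  have "U = V"
    unfolding assms(2) V(3) by (rule differences_translate_subspace[OF V(1)])
  with V have U: "subspace U" "closed U" by simp_all
  obtain c where c: "c \<in> A" "inner c v = \<beta>"
    using assms(4,5) by auto
  have A: "A = (+) c ` U"
    using translate_subspace_rebase[OF V(1)] c(1) V(3) \<open>U = V\<close> by blast
  define W where "W = U \<inter> {u. inner v u = 0}"
  have W: "subspace W" "closed W"
    unfolding W_def using U by (auto intro: subspace_inter subspace_hyperplane closed_hyperplane)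
  have AB: "A \<inter> B = (+) c ` W"
  proof -
    have "inner (c + u) v = \<beta> \<longleftrightarrow> inner v u = 0" for u
      using c(2) by (simp add: inner_add_left inner_commute[of u v])
    then show ?thesis
      unfolding A W_def assms(4) by blast
  qed
  define w where "w = proj U v"
  have w: "w \<in> U" "\<And>u. u \<in> U \<Longrightarrow> inner v u = inner w u"
    using proj_subspace_eq_iff[OF U, of v w] by (auto simp: w_def inner_diff_left)
  define p where "p = proj A x"
  have p: "p \<in> (+) c ` U" "\<And>u. u \<in> U \<Longrightarrow> inner (x - p) u = 0"
    using proj_translate_eq_iff[OF U, of c x p] by (auto simp: p_def A)
  show ?thesis
  proof (cases "w = 0")
    case True
    then have "W = U"
      using w(2) by (auto simp: W_def)
    then have "A \<inter> B = A"
      using A AB by simp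
    then show ?thesis
      using True by (simp add: w_def)
  next
    case False
    define t where "t = (\<beta> - inner p v) / (norm w)\<^sup>2"
    obtain u where u: "u \<in> U" "p = c + u"
      using p(1) by auto
    have "t * inner v w = \<beta> - inner p v"
      using False w(2)[OF w(1)] by (simp add: t_def power2_norm_eq_inner)
    then have "inner v (u + t *\<^sub>R w) = 0"
      using u(2) c(2) by (simp add: inner_add_right inner_add_left inner_commute)
    then have "u + t *\<^sub>R w \<in> W"
      using U(1) u(1) w(1) by (simp add: W_def subspace_add subspace_scale)
    then have "p + t *\<^sub>R w \<in> (+) c ` W"
      using u(2) by (simp add: add.assoc)
    moreover have "inner (x - (p + t *\<^sub>R w)) z = 0" if "z \<in> W" for z
    proof -
      have "z \<in> U" "inner w z = 0"
        using that w(2) by (auto simp: W_def)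
      then show ?thesis
        using p(2)[of z] by (simp add: inner_diff_left inner_add_left)
    qed
    ultimately have "proj (A \<inter> B) x = p + t *\<^sub>R w"
      unfolding AB by (simp add: proj_translate_eq_iff[OF W])
    then show ?thesis
      using False by (simp add: w_def p_def t_def)
  qed
qed

end
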